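(* Let $n\ge 2$ be an integer, $k\in\{1,\dots,n\}$, and let $0\le a_1\le a_2\le\cdots\le a_n\le 1$ be real numbers. Let $p$ be the largest integer in $\{0,1,\dots,\lfloor (n-1)/2\rfloor\}$ such that $a_{2i}+a_{2i+1}\le 1$ for all $1\le i\le p$, and let $m$ be the largest integer in $\{0,1,\dots,\lfloor n/2\rfloor\}$ such that $a_{2i-1}+a_{2i}\le 1$ for all $1\le i\le m$. Let $P$ be any probability measure on $(\Omega,\Sigma)$ with $P(A_j)=a_j$ for all $j\in[n]$ and with respect to which $A_1,\dots,A_n$ are $(n-1)$-wise independent, and let $P(n,k,\mathbf{a})$ denote the probability under $P$ that at least $k$ of the events $A_1,\dots,A_n$ occur. Then: (i) if $k$ is odd, $$P_0(n,k,\mathbf{a})-\binom{n-1}{k-1}\prod_{i=1}^{2p+1}a_i\prod_{i=2p+2}^{n}(1-a_i)\;\le\; P(n,k,\mathbf{a})\;\le\; P_0(n,k,\mathbf{a})+\binom{n-1}{k-1}\prod_{i=1}^{2m}a_i\prod_{i=2m+1}^{n}(1-a_i);$$ (ii) if $k$ is even, $$P_0(n,k,\mathbf{a})-\binom{n-1}{k-1}\prod_{i=1}^{2m}a_i\prod_{i=2m+1}^{n}(1-a_i)\;\le\; P(n,k,\mathbf{a})\;\le\; P_0(n,k,\mathbf{a})+\binom{n-1}{k-1}\prod_{i=1}^{2p+1}a_i\prod_{i=2p+2}^{n}(1-a_i).$$ Moreover, all the bounds are sharp. Among the probability measures $P$ considered, the lower bound for odd $k$ and the upper bound for even $k$ are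 each achieved by exactly one measure, namely $P(\mathbf{A}^J)=\mathbf{a}^J+(-1)^{|J|}s$ ($J\subseteq[n]$) with $s=\prod_{i=1}^{2p+1}a_i\prod_{i=2p+2}^{n}(1-a_i)$; the upper bound for odd $k$ and the lower bound for even $k$ are each achieved by exactly one measure, namely $P(\mathbf{A}^J)=\mathbf{a}^J+(-1)^{|J|}s$ ($J\subseteq[n]$) with $s=-\prod_{i=1}^{2m}a_i\prod_{i=2m+1}^{n}(1-a_i)$.
   Context: Here $[n]=\{1,\dots,n\}$ and $\Omega=\{\omega_J: J\subseteq[n]\}$ is a set with $2^n$ elements, the sample space freely generated by $n$ events $A_1,\dots,A_n\subseteq\Omega$; that is, $A_j=\{\omega_J: j\in J\}$, so that $\{\omega_J\}=\mathbf{A}^J:=\bigcap_{j\in J}A_j\cap\bigcap_{j\notin J}\overline{A}_j$ for every $J\subseteq[n]$. $\Sigma$ is the $\sigma$-algebra of all subsets of $\Omega$. For $J\subseteq[n]$ put $\mathbf{a}^J:=\prod_{j\in J}a_j\prod_{j\in[n]\setminus J}(1-a_j)$. The events $A_1,\dots,A_n$ are $(n-1)$-wise independent with respect to $P$ if any $n-1$ of them are mutually independent, i.e. $P(\bigcap_{j\in J}A_j)=\prod_{j\in J}P(A_j)$ for every $J\subseteq[n]$ with $|J|\le n-1$. $P(n,k,\mathbf{a})=\sum_{J\subseteq[n],\,|J|\ge k}P(\mathbf{A}^J)$, and $P_0(n,k,\mathbf{a}):=\sum_{J\subseteq[n],\,|J|\ge k}\mathbf{a}^J$ is the probability that at least $k$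 of $n$ mutually independent events with marginal probabilities $a_1,\dots,a_n$ occur. Empty products equal $1$. *)

theory Defs
  imports "HOL-Probability.Probability"
begin

text \<open>The outcome \<open>\<omega>\<^sub>J\<close> is represented by the index set \<open>J\<close> itself.\<close>

definition sample_space :: "nat \<Rightarrow> nat set set" where
  "sample_space n = Pow {1..n}"

definition gen_event :: "nat \<Rightarrow> nat \<Rightarrow> nat set set" where
  "gen_event n j = {\<omega> \<in> sample_space n. j \<in> \<omega>}"

text \<open>The leading \<open>sample_space n\<close> only matters for \<open>n = 0\<close>, where both intersections are
  \<open>UNIV\<close>.\<close>

definition atom_event :: "nat \<Rightarrow> nat set \<Rightarrow> nat set set" where
  "atom_event n J = sample_space n \<inter> (\<Inter>j\<in>J. gen_event n j) \<inter>
     (\<Inter>j\<in>{1..n} - J. sample_space n - gen_event n j)"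

definition indep_weight :: "nat \<Rightarrow> (nat \<Rightarrow> real) \<Rightarrow> nat set \<Rightarrow> real" where
  "indep_weight n a J = (\<Prod>j\<in>J. a j) * (\<Prod>j\<in>{1..n} - J. 1 - a j)"

definition prob_at_least :: "nat \<Rightarrow> nat \<Rightarrow> nat set measure \<Rightarrow> real" where
  "prob_at_least n k P = (\<Sum>J | J \<subseteq> {1..n} \<and> k \<le> card J. measure P (atom_event n J))"

definition indep_prob_at_least :: "nat \<Rightarrow> nat \<Rightarrow> (nat \<Rightarrow> real) \<Rightarrow> real" where
  "indep_prob_at_least n k a = (\<Sum>J | J \<subseteq> {1..n} \<and> k \<le> card J. indep_weight n a J)"

definition kwise_indep_events :: "nat \<Rightarrow> 'w measure \<Rightarrow> (nat \<Rightarrow> 'w set) \<Rightarrow> nat \<Rightarrow> bool" where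
  "kwise_indep_events r P A n \<longleftrightarrow>
     (\<forall>I. I \<subseteq> {1..n} \<and> card I = r \<longrightarrow> prob_space.indep_events P A I)"

definition admissible :: "nat \<Rightarrow> (nat \<Rightarrow> real) \<Rightarrow> nat set measure set" where
  "admissible n a = {P. prob_space P \<and> space P = sample_space n \<and> sets P = Pow (sample_space n) \<and>
     (\<forall>j\<in>{1..n}. measure P (gen_event n j) = a j) \<and>
     kwise_indep_events (n - 1) P (gen_event n) n}"

definition prefix_prod :: "nat \<Rightarrow> (nat \<Rightarrow> real) \<Rightarrow> nat \<Rightarrow> real" where
  "prefix_prod n a r = (\<Prod>i\<in>{1..r}. a i) * (\<Prod>i\<in>{r + 1..n}. 1 - a i)"

definition has_perturbed_weights :: "nat \<Rightarrow> (nat \<Rightarrow> real) \<Rightarrow> real \<Rightarrow> nat set measure \<Rightarrow> bool" where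
  "has_perturbed_weights n a s P \<longleftrightarrow>
     (\<forall>J. J \<subseteq> {1..n} \<longrightarrow> measure P (atom_event n J) = indep_weight n a J + (-1) ^ card J * s)"

lemma atom_event_eq: "J \<subseteq> {1..n} \<Longrightarrow> atom_event n J = {J}"
  by (auto simp: atom_event_def gen_event_def sample_space_def)

lemma kwise_indep_events_iff:
  assumes "prob_space P" and "\<And>j. j \<in> {1..n} \<Longrightarrow> A j \<in> sets P" and "r \<le> n"
  shows "kwise_indep_events r P A n \<longleftrightarrow>
    (\<forall>J. J \<subseteq> {1..n} \<and> J \<noteq> {} \<and> card J \<le> r \<longrightarrow>
       measure P (\<Inter>j\<in>J. A j) = (\<Prod>j\<in>J. measure P (A j)))" (is "?L \<longleftrightarrow> ?R")
proof
  assume L: ?L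
  show ?R
  proof (intro allI impI)
    fix J :: "nat set" assume J: "J \<subseteq> {1..n} \<and> J \<noteq> {} \<and> card J \<le> r"
    then obtain I where I: "J \<subseteq> I" "I \<subseteq> {1..n}" "card I = r"
      using exists_subset_between[of J r "{1..n}"] \<open>r \<le> n\<close> by (metis card_atLeastAtMost diff_Suc_1 finite_atLeastAtMost)
    have "finite J" using J finite_subset[of J "{1..n}"] by simp
    then show "measure P (\<Inter>j\<in>J. A j) = (\<Prod>j\<in>J. measure P (A j))"
    proof -
      have "prob_space.indep_events P A I"
        using L I(2,3) unfolding kwise_indep_events_def by simp
      then show ?thesis
        using I(1) J \<open>finite J\<close> unfolding prob_space.indep_events_def[OF assms(1)] by simp
    qed
  qed
next
  assume R: ?R
  show ?L
    unfolding kwise_indep_events_def prob_space.indep_events_def[OF assms(1)]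
  proof (intro allI impI conjI)
    fix I :: "nat set" assume I: "I \<subseteq> {1..n} \<and> card I = r"
    show "A ` I \<subseteq> sets P" using I assms(2) by auto
    fix J assume J: "J \<subseteq> I" "J \<noteq> {}" "finite J"
    have "finite I" using I finite_subset[of I "{1..n}"] by simp
    then have "card J \<le> r" using I J(1) card_mono[of I J] by simp
    moreover have "J \<subseteq> {1..n}" using I J(1) by (meson subset_trans)
    ultimately show "measure P (\<Inter>j\<in>J. A j) = (\<Prod>j\<in>J. measure P (A j))"
      using R J(2) by simp
  qed
qed

lemma prob_at_least_eq:
  assumes "P \<in> admissible n a"
  shows "prob_at_least n k P =
    measure P {\<omega> \<in> space P. k \<le> card {j \<in> {1..n}. \<omega> \<in> gen_event n j}}"
proof -
  interpret prob_space P using assms by (simp add: admissible_def)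
  have S: "space P = Pow {1..n}" "sets P = Pow (Pow {1..n})"
    using assms by (auto simp: admissible_def sample_space_def)
  let ?K = "{J. J \<subseteq> {1..n} \<and> k \<le> card J}"
  have fin: "finite ?K" by (rule finite_subset[of _ "Pow {1..n}"]) auto
  have "{j \<in> {1..n}. \<omega> \<in> gen_event n j} = \<omega>" if "\<omega> \<subseteq> {1..n}" for \<omega>
    using that by (auto simp: gen_event_def sample_space_def)
  then have eq: "{\<omega> \<in> space P. k \<le> card {j \<in> {1..n}. \<omega> \<in> gen_event n j}} = ?K"
    using S by auto
  have "prob_at_least n k P = (\<Sum>J\<in>?K. measure P {J})"
    unfolding prob_at_least_def by (rule sum.cong) (auto simp: atom_event_eq)
  also have "\<dots> = measure P ?K"
    by (rule measure_eq_sum_singleton[symmetric]) (use fin S in auto)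
  finally show ?thesis using eq by simp
qed

end

theory Submission
  imports Defs
begin

text \<open>Independence of any \<open>n - 1\<close> of the events fixes the sums of \<open>P(A\<^sup>K) - a\<^sup>K\<close> over all
  \<open>K \<supseteq> J\<close> with \<open>J \<noteq> [n]\<close>. The solutions of this linear system are exactly the multiples of
  \<open>(-1)\<^bsup>|K|\<^esup>\<close>, so the admissible measures form a segment parametrised by the
  perturbation \<open>s\<close>, and \<open>P(n,k,a)\<close> depends on \<open>s\<close> affinely with slope
  \<open>(-1)\<^sup>k\<close> times \<open>n - 1\<close> choose \<open>k - 1\<close>. Nonnegativity of the weights confines \<open>s\<close> to the interval
  from \<open>- min a\<^sup>J\<close> over even \<open>|J|\<close> to \<open>min a\<^sup>J\<close> over odd \<open>|J|\<close>. Since \<open>a\<close> is sorted, the minimum over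
  sets of size \<open>r\<close> is attained at the prefix \<open>{1..r}\<close>, and passing from the prefix of length \<open>r\<close> to
  that of length \<open>r + 2\<close> decreases the weight as long as \<open>a\<^bsub>r+1\<^esub> + a\<^bsub>r+2\<^esub> \<le> 1\<close>.\<close>

section \<open>Sums over supersets and alternating sums\<close>

text \<open>Replacing \<open>y\<close> by 0 on \<open>J\<close> kills the terms whose
  \<open>K\<close> does not contain \<open>J\<close> and leaves the others unchanged. The sum then
  runs over all subsets of \<open>S\<close> and is the expansion of the product of the binomials
  \<open>x i + z i\<close>.\<close>

lemma sum_supersets_prod:
  fixes x y :: "'a \<Rightarrow> 'b::comm_ring_1"
  assumes "finite S" "J \<subseteq> S"
  shows "(\<Sum>K | J \<subseteq> K \<and> K \<subseteq> S. (\<Prod>i\<in>K. x i) * (\<Prod>i\<in>S - K. y i))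
    = (\<Prod>i\<in>J. x i) * (\<Prod>i\<in>S - J. x i + y i)"
proof -
  define z where "z i = (if i \<in> J then 0 else y i)" for i
  have "(\<Sum>K\<in>Pow S. (\<Prod>i\<in>K. x i) * (\<Prod>i\<in>S - K. z i))
    = (\<Sum>K | J \<subseteq> K \<and> K \<subseteq> S. (\<Prod>i\<in>K. x i) * (\<Prod>i\<in>S - K. y i))"
  proof (rule sum.mono_neutral_cong_right)
    show "\<forall>K\<in>Pow S - {K. J \<subseteq> K \<and> K \<subseteq> S}. (\<Prod>i\<in>K. x i) * (\<Prod>i\<in>S - K. z i) = 0"
    proof
      fix K assume "K \<in> Pow S - {K. J \<subseteq> K \<and> K \<subseteq> S}"
      then obtain i where "i \<in> S - K" "i \<in> J" using assms by auto
      then have "(\<Prod>i\<in>S - K. z i) = 0"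
        using assms(1) by (intro prod_zero) (auto simp: z_def)
      then show "(\<Prod>i\<in>K. x i) * (\<Prod>i\<in>S - K. z i) = 0" by simp
    qed
    fix K assume "K \<in> {K. J \<subseteq> K \<and> K \<subseteq> S}"
    then have "(\<Prod>i\<in>S - K. z i) = (\<Prod>i\<in>S - K. y i)"
      by (intro prod.cong) (auto simp: z_def)
    then show "(\<Prod>i\<in>K. x i) * (\<Prod>i\<in>S - K. z i) = (\<Prod>i\<in>K. x i) * (\<Prod>i\<in>S - K. y i)" by simp
  qed (use assms in auto)
  moreover have "(\<Prod>i\<in>S. x i + z i) = (\<Prod>i\<in>J. x i) * (\<Prod>i\<in>S - J. x i + y i)"
    unfolding prod.subset_diff[OF assms(2,1)]
    by (subst mult.commute, intro arg_cong2[of _ _ _ _ "(*)"] prod.cong) (auto simp: z_def)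
  ultimately show ?thesis
    using prod_add[OF assms(1), of x z] by simp
qed

text \<open>Each element of \<open>S - J\<close> contributes a factor -1 + 1, and there is one
  because \<open>J\<close> is proper. Hence adding a multiple of \<open>(-1) ^ card K\<close> to the
  weights changes no superset sum over a proper \<open>J\<close>.\<close>

lemma sum_supersets_alternating:
  assumes "finite S" "J \<subset> S"
  shows "(\<Sum>K | J \<subseteq> K \<and> K \<subseteq> S. (-1::real) ^ card K) = 0"
proof -
  have "S - J \<noteq> {}" "finite (S - J)" using assms by auto
  then have "(\<Prod>i\<in>S - J. (-1::real) + 1) = 0" by (simp add: card_gt_0_iff)
  then show ?thesis
    using sum_supersets_prod[of S J "\<lambda>_. -1::real" "\<lambda>_. 1"] assms by auto
qed

text \<open>The superset sums form a triangular system (Moebius inversion): going down from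
  \<open>S\<close>, all proper supersets of \<open>J\<close> already have value 0, so the sum at
  \<open>J\<close> reduces to \<open>f J\<close>.\<close>

lemma sum_supersets_eq_0_imp_eq_0:
  fixes f :: "'a set \<Rightarrow> real"
  assumes "finite S" "J \<subseteq> S" and z: "\<And>J. J \<subseteq> S \<Longrightarrow> (\<Sum>K | J \<subseteq> K \<and> K \<subseteq> S. f K) = 0"
  shows "f J = 0"
  using \<open>J \<subseteq> S\<close>
proof (induction "card (S - J)" arbitrary: J rule: less_induct)
  case less
  have fin: "finite {K. J \<subseteq> K \<and> K \<subseteq> S}"
    by (rule finite_subset[of _ "Pow S"]) (use assms in auto)
  have "(\<Sum>K\<in>{K. J \<subseteq> K \<and> K \<subseteq> S} - {J}. f K) = 0"
  proof (intro sum.neutral ballI)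
    fix K assume "K \<in> {K. J \<subseteq> K \<and> K \<subseteq> S} - {J}"
    then have K: "J \<subseteq> K" "K \<subseteq> S" "K \<noteq> J" by auto
    then have "S - K \<subset> S - J" by auto
    then have "card (S - K) < card (S - J)"
      using \<open>finite S\<close> by (intro psubset_card_mono) auto
    then show "f K = 0" using less.hyps K by blast
  qed
  then show ?case
    using z[OF less.prems] sum.remove[OF fin, of J f] less.prems by auto
qed

text \<open>Grouping by cardinality leaves a tail of the alternating sum of binomial coefficients,
  which telescopes by Pascal's rule.\<close>

lemma sum_alternating_card_ge:
  assumes "k \<in> {1..n}"
  shows "(\<Sum>J | J \<subseteq> {1..n} \<and> k \<le> card J. (-1::real) ^ card J)
    = (-1) ^ k * real ((n - 1) choose (k - 1))"
proof -
  \<comment> \<open>A discrete antiderivative of \<open>(-1) ^ j * real (n choose j)\<close>, read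
    off from Pascal's rule.\<close>
  define u where "u j = - ((-1) ^ j * real ((n - 1) choose (j - 1)))" for j
  let ?S = "{J. J \<subseteq> {1..n} \<and> k \<le> card J}"
  have fin: "finite ?S" by (rule finite_subset[of _ "Pow {1..n}"]) auto
  have img: "card ` ?S \<subseteq> {k..n}"
    using card_mono[of "{1..n}"] by force
  have "(\<Sum>J\<in>?S. (-1::real) ^ card J)
    = (\<Sum>j\<in>{k..n}. \<Sum>J | J \<in> ?S \<and> card J = j. (-1) ^ card J)"
    by (rule sum.group[symmetric]) (use fin img in auto)
  also have "\<dots> = (\<Sum>j\<in>{k..n}. u (Suc j) - u j)"
  proof (rule sum.cong[OF refl])
    fix j assume j: "j \<in> {k..n}"
    have "{J. J \<in> ?S \<and> card J = j} = {J. J \<subseteq> {1..n} \<and> card J = j}" using j by auto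
    then have "(\<Sum>J | J \<in> ?S \<and> card J = j. (-1::real) ^ card J) = (-1) ^ j * real (n choose j)"
      by (simp add: n_subsets)
    also have "\<dots> = u (Suc j) - u j"
    proof -
      \<comment> \<open>Here \<open>j\<close> is positive since \<open>k\<close> is; at 0 the
        truncated \<open>j - 1\<close> would break Pascal's rule.\<close>
      obtain n' j' where "n = Suc n'" "j = Suc j'"
        using j assms by (cases n; cases j) auto
      then show ?thesis by (simp add: u_def algebra_simps)
    qed
    finally show "(\<Sum>J | J \<in> ?S \<and> card J = j. (-1::real) ^ card J) = u (Suc j) - u j" .
  qed
  also have "\<dots> = u (Suc n) - u k"
    by (rule sum_Suc_diff) (use assms in simp)
  \<comment> \<open>The end term \<open>u (Suc n)\<close> vanishes, as
    \<open>(n - 1) choose n\<close> is 0.\<close>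
  also have "\<dots> = (-1) ^ k * real ((n - 1) choose (k - 1))"
    using assms by (simp add: u_def)
  finally show ?thesis .
qed

section \<open>Index sets of least weight for each parity of the size\<close>

text \<open>Both products are compared with the same power of the separating value
  \<open>c\<close>.\<close>

lemma prod_mono_separated:
  fixes f :: "'a \<Rightarrow> real"
  assumes "card A = card B" "\<And>i. i \<in> A \<Longrightarrow> 0 \<le> f i \<and> f i \<le> c" "\<And>i. i \<in> B \<Longrightarrow> c \<le> f i" "0 \<le> c"
  shows "prod f A \<le> prod f B"
proof -
  have "prod f A \<le> (\<Prod>i\<in>A. c)" using assms by (intro prod_mono) auto
  also have "\<dots> = (\<Prod>i\<in>B. c)" using assms by simp
  also have "\<dots> \<le> prod f B" using assms by (intro prod_mono) auto
  finally show ?thesis .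
qed

lemma sorted_unit_interval:
  assumes "0 \<le> a 1" "a n \<le> (1::real)" "mono_on {1..n::nat} a" "i \<in> {1..n}"
  shows "0 \<le> a i" "a i \<le> 1"
proof -
  have "a 1 \<le> a i" "a i \<le> a n"
    using assms(4) by (auto intro!: mono_onD[OF assms(3)])
  then show "0 \<le> a i" "a i \<le> 1" using assms by linarith+
qed

lemma indep_weight_prefix:
  assumes "r \<le> n"
  shows "indep_weight n a {1..r} = prefix_prod n a r"
proof -
  have "{1..n} - {1..r} = {r + 1..n}" by auto
  then show ?thesis by (simp add: indep_weight_def prefix_prod_def)
qed

text \<open>An exchange argument. \<open>{1..r} - J\<close> and \<open>J - {1..r}\<close> have equal
  size and are separated by the value \<open>a r\<close>; swapping the second for the first lowers
  the product of the \<open>a i\<close> and, since \<open>1 - a i\<close> is antitone in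
  \<open>i\<close>, also the product of the complements.\<close>

lemma prefix_prod_card_le_indep_weight:
  assumes a: "0 \<le> a 1" "a n \<le> 1" "mono_on {1..n} a" and J: "J \<subseteq> {1..n}"
  shows "prefix_prod n a (card J) \<le> indep_weight n a J"
proof -
  define r where "r = card J"
  note rng = sorted_unit_interval[OF a]
  have fJ: "finite J" using J finite_subset by blast
  have rn: "r \<le> n" unfolding r_def using card_mono[OF _ J] by simp
  let ?I = "{1..r}"
  have cd: "card (?I - J) = card (J - ?I)"
    using card_le_sym_Diff[of ?I J] card_le_sym_Diff[of J ?I] fJ by (simp add: r_def)
  have main: "prod a (?I - J) \<le> prod a (J - ?I) \<and>
      (\<Prod>i\<in>J - ?I. 1 - a i) \<le> (\<Prod>i\<in>?I - J. 1 - a i)"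
  \<comment> \<open>For \<open>r = 0\<close> the separator would be \<open>a 0\<close>, which the
    hypotheses do not control; both differences are empty then.\<close>
  proof (cases "r = 0")
    case True
    then show ?thesis using fJ by (simp add: r_def)
  next
    case False
    then have r: "r \<in> {1..n}" using rn by auto
    have lo: "a i \<le> a r" if "i \<in> ?I - J" for i
      using that r by (intro mono_onD[OF a(3)]) auto
    have hi: "a r \<le> a i" if "i \<in> J - ?I" for i
      using that r J by (intro mono_onD[OF a(3)]) auto
    have ri: "0 \<le> a i" "a i \<le> 1" if "i \<in> ?I \<union> J" for i
      using that rng[of i] J rn by auto
    show ?thesis
      using lo hi ri rng[OF r] cd
      by (intro conjI prod_mono_separated[where c = "a r"] prod_mono_separated[where c = "1 - a r"]) auto
  qed
  have nn: "0 \<le> a i" "0 \<le> 1 - a i" if "i \<in> {1..n}" for i using rng[OF that] by auto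
  let ?C = "{1..n} - J - ?I"
  \<comment> \<open>The factors over \<open>?I \<inter> J\<close> and over \<open>?C\<close> are
    common to both weights, so only the exchanged differences need comparison.\<close>
  have "prefix_prod n a r = (prod a (?I \<inter> J) * prod a (?I - J)) *
      ((\<Prod>i\<in>J - ?I. 1 - a i) * (\<Prod>i\<in>?C. 1 - a i))"
  proof -
    have "prod a ?I = prod a (?I \<inter> J) * prod a (?I - J)"
      by (rule prod.Int_Diff) simp
    moreover have "(\<Prod>i\<in>{1..n} - ?I. 1 - a i) = (\<Prod>i\<in>J - ?I. 1 - a i) * (\<Prod>i\<in>?C. 1 - a i)"
      using J by (subst prod.union_disjoint[symmetric]) (auto intro: fJ prod.cong)
    ultimately show ?thesis by (simp add: indep_weight_prefix[OF rn, symmetric] indep_weight_def)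
  qed
  also have "\<dots> \<le> (prod a (?I \<inter> J) * prod a (J - ?I)) *
      ((\<Prod>i\<in>?I - J. 1 - a i) * (\<Prod>i\<in>?C. 1 - a i))"
    using main J rn nn
    by (intro mult_mono mult_nonneg_nonneg prod_nonneg) (auto simp: subset_iff)
  also have "\<dots> = indep_weight n a J"
  proof -
    have "prod a J = prod a (?I \<inter> J) * prod a (J - ?I)"
      by (subst prod.Int_Diff[OF fJ, of _ ?I]) (simp add: Int_commute)
    moreover have "(\<Prod>i\<in>{1..n} - J. 1 - a i) = (\<Prod>i\<in>?I - J. 1 - a i) * (\<Prod>i\<in>?C. 1 - a i)"
      using rn by (subst prod.union_disjoint[symmetric]) (auto intro: prod.cong)
    ultimately show ?thesis by (simp add: indep_weight_def)
  qed
  finally show ?thesis by (simp add: r_def)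
qed

text \<open>Only the factors at \<open>r + 1\<close> and \<open>r + 2\<close> differ, and
  \<open>x * y - (1 - x) * (1 - y) = x + y - 1\<close>.\<close>

lemma prefix_prod_diff:
  assumes "r + 2 \<le> n"
  shows "prefix_prod n a (r + 2) - prefix_prod n a r
    = (\<Prod>i\<in>{1..r}. a i) * (\<Prod>i\<in>{r + 3..n}. 1 - a i) * (a (r + 1) + a (r + 2) - 1)"
proof -
  have "{1..r + 2} = {1..r} \<union> {r + 1, r + 2}" "{r + 1..n} = {r + 1, r + 2} \<union> {r + 3..n}"
    using assms by auto
  then have split: "(\<Prod>i\<in>{1..r + 2}. a i) = (\<Prod>i\<in>{1..r}. a i) * (a (r + 1) * a (r + 2))"
    "(\<Prod>i\<in>{r + 1..n}. 1 - a i)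
      = (1 - a (r + 1)) * (1 - a (r + 2)) * (\<Prod>i\<in>{r + 3..n}. 1 - a i)"
    by (simp_all only: prod.union_disjoint) (auto simp: prod.union_disjoint)
  have "r + 2 + 1 = r + 3" by simp
  then show ?thesis
    unfolding prefix_prod_def split by (simp only: algebra_simps)
qed

lemma prefix_prod_step:
  assumes a: "0 \<le> a 1" "a n \<le> 1" "mono_on {1..n} a" and r: "r + 2 \<le> n"
  shows "a (r + 1) + a (r + 2) \<le> 1 \<Longrightarrow> prefix_prod n a (r + 2) \<le> prefix_prod n a r"
    and "1 \<le> a (r + 1) + a (r + 2) \<Longrightarrow> prefix_prod n a r \<le> prefix_prod n a (r + 2)"
proof -
  have C: "0 \<le> (\<Prod>i\<in>{1..r}. a i) * (\<Prod>i\<in>{r + 3..n}. 1 - a i)" (is "0 \<le> ?C")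
    using sorted_unit_interval[OF a] r by (intro mult_nonneg_nonneg prod_nonneg) auto
  show "prefix_prod n a (r + 2) \<le> prefix_prod n a r" if "a (r + 1) + a (r + 2) \<le> 1"
    using prefix_prod_diff[OF r, of a] mult_nonneg_nonpos[OF C, of "a (r + 1) + a (r + 2) - 1"] that
    by simp
  show "prefix_prod n a r \<le> prefix_prod n a (r + 2)" if "1 \<le> a (r + 1) + a (r + 2)"
    using prefix_prod_diff[OF r, of a] mult_nonneg_nonneg[OF C, of "a (r + 1) + a (r + 2) - 1"] that
    by simp
qed

text \<open>As \<open>c\<close> is monotone, it crosses the level 1 at most once: \<open>f\<close>
  descends up to the crossing point \<open>q\<close> and ascends afterwards. Below, \<open>f\<close>
  is the prefix weight along one parity and \<open>c\<close> the sum of the two values added at each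
  step.\<close>

lemma unimodal_min:
  fixes f c :: "nat \<Rightarrow> real"
  assumes dec: "\<And>i. i < N \<Longrightarrow> c (Suc i) \<le> 1 \<Longrightarrow> f (Suc i) \<le> f i"
    and inc: "\<And>i. i < N \<Longrightarrow> 1 \<le> c (Suc i) \<Longrightarrow> f i \<le> f (Suc i)"
    and mono: "mono_on {1..N} c"
    and q: "q = Max {q \<in> {0..N}. \<forall>i\<in>{1..q}. c i \<le> 1}"
    and t: "t \<le> N"
  shows "q \<le> N" "f q \<le> f t"
proof -
  let ?S = "{q \<in> {0..N}. \<forall>i\<in>{1..q}. c i \<le> 1}"
  have "finite ?S" "0 \<in> ?S" by auto
  then have qS: "q \<in> ?S" unfolding q by (intro Max_in) auto
  then show qN: "q \<le> N" by simp
  \<comment> \<open>If \<open>c i\<close> were at most 1, monotonicity would put \<open>i\<close>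
    itself into the set whose maximum is \<open>q\<close>.\<close>
  have big: "1 < c i" if "q < i" "i \<le> N" for i
  proof (rule ccontr)
    assume "\<not> 1 < c i"
    then have "c j \<le> 1" if "j \<in> {1..i}" for j
      using mono_onD[OF mono, of j i] that \<open>i \<le> N\<close> by fastforce
    then have "i \<in> ?S" using that by auto
    then have "i \<le> q" unfolding q by (intro Max_ge) auto
    then show False using that by simp
  qed
  show "f q \<le> f t"
  proof (cases "t \<le> q")
    case True
    then show ?thesis
    proof (induction rule: inc_induct)
      case (step i)
      then have "f (Suc i) \<le> f i" using qS by (intro dec) auto
      then show ?case using step by simp
    qed simp
  next
    case False
    then have "q \<le> t" by simp
    then show ?thesis using t
    proof (induction rule: dec_induct)
      case (step i)
      then have "f i \<le> f (Suc i)" using big[of "Suc i"] by (intro inc) auto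
      then show ?case using step by simp
    qed simp
  qed
qed

text \<open>Going from \<open>2 * i\<close> to \<open>2 * Suc i\<close> adds the indices
  \<open>2 * i + 1\<close> and \<open>2 * i + 2\<close>, whose sum is the one tested at
  \<open>Suc i\<close> in the definition of \<open>m\<close>. The best even prefix then beats every
  even set through the prefix of the same size.\<close>

lemma even_prefix_minimal:
  assumes a: "0 \<le> a 1" "a n \<le> 1" "mono_on {1..n} a"
    and m: "m = Max {q \<in> {0..n div 2}. \<forall>i\<in>{1..q}. a (2 * i - 1) + a (2 * i) \<le> 1}"
  shows "2 * m \<le> n"
    and "J \<subseteq> {1..n} \<Longrightarrow> even (card J) \<Longrightarrow> prefix_prod n a (2 * m) \<le> indep_weight n a J"
proof -
  have mono: "mono_on {1..n div 2} (\<lambda>i. a (2 * i - 1) + a (2 * i))"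
    by (intro mono_onI add_mono mono_onD[OF a(3)]) auto
  have *: "m \<le> n div 2 \<and> prefix_prod n a (2 * m) \<le> prefix_prod n a (2 * t)" if "t \<le> n div 2" for t
    using unimodal_min[OF _ _ mono m that, of "\<lambda>i. prefix_prod n a (2 * i)"]
      prefix_prod_step[OF a, of "2 * i" for i]
    by (auto simp: algebra_simps)
  show "2 * m \<le> n" using *[of 0] by auto
  show "prefix_prod n a (2 * m) \<le> indep_weight n a J" if J: "J \<subseteq> {1..n}" "even (card J)"
  proof -
    obtain t where t: "card J = 2 * t" using J(2) by (elim evenE)
    have "card J \<le> n" using card_mono[OF _ J(1)] by simp
    then have "t \<le> n div 2" using t by simp
    then have "prefix_prod n a (2 * m) \<le> prefix_prod n a (card J)" using * t by simp
    then show ?thesis using prefix_prod_card_le_indep_weight[OF a J(1)] by simp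
  qed
qed

text \<open>The same along odd prefixes, with the pairs shifted by one because index 1 always
  belongs to the prefix. For \<open>n = 0\<close> truncated subtraction would still give
  \<open>p = 0\<close>, hence the guard on \<open>n\<close>.\<close>

lemma odd_prefix_minimal:
  assumes a: "0 \<le> a 1" "a n \<le> 1" "mono_on {1..n} a" and n: "1 \<le> n"
    and p: "p = Max {q \<in> {0..(n - 1) div 2}. \<forall>i\<in>{1..q}. a (2 * i) + a (2 * i + 1) \<le> 1}"
  shows "2 * p + 1 \<le> n"
    and "J \<subseteq> {1..n} \<Longrightarrow> odd (card J) \<Longrightarrow> prefix_prod n a (2 * p + 1) \<le> indep_weight n a J"
proof -
  have mono: "mono_on {1..(n - 1) div 2} (\<lambda>i. a (2 * i) + a (2 * i + 1))"
    by (intro mono_onI add_mono mono_onD[OF a(3)]) auto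
  have *: "p \<le> (n - 1) div 2 \<and> prefix_prod n a (2 * p + 1) \<le> prefix_prod n a (2 * t + 1)"
    if "t \<le> (n - 1) div 2" for t
    using unimodal_min[OF _ _ mono p that, of "\<lambda>i. prefix_prod n a (2 * i + 1)"]
      prefix_prod_step[OF a, of "2 * i + 1" for i]
    by (auto simp: algebra_simps)
  show "2 * p + 1 \<le> n" using *[of 0] n by auto
  show "prefix_prod n a (2 * p + 1) \<le> indep_weight n a J" if J: "J \<subseteq> {1..n}" "odd (card J)"
  proof -
    obtain t where t: "card J = 2 * t + 1" using J(2) by (elim oddE)
    have "card J \<le> n" using card_mono[OF _ J(1)] by simp
    then have "t \<le> (n - 1) div 2" using t by simp
    then have "prefix_prod n a (2 * p + 1) \<le> prefix_prod n a (card J)" using * t by simp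
    then show ?thesis using prefix_prod_card_le_indep_weight[OF a J(1)] by simp
  qed
qed

section \<open>The admissible measures as a one-parameter family\<close>

lemma sum_supersets_indep_weight:
  assumes "J \<subseteq> {1..n}"
  shows "(\<Sum>K | J \<subseteq> K \<and> K \<subseteq> {1..n}. indep_weight n a K) = (\<Prod>j\<in>J. a j)"
  using sum_supersets_prod[OF _ assms, of a "\<lambda>i. 1 - a i"] by (simp add: indep_weight_def)

text \<open>\<open>J\<close> must be nonempty because the empty intersection is \<open>UNIV\<close>,
  not the sample space.\<close>

lemma measure_Inter_gen_event:
  assumes "prob_space P" "space P = sample_space n" "sets P = Pow (sample_space n)" "J \<noteq> {}"
  shows "measure P (\<Inter>j\<in>J. gen_event n j) = (\<Sum>K | J \<subseteq> K \<and> K \<subseteq> {1..n}. measure P {K})"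
proof -
  interpret prob_space P by fact
  have fin: "finite {K. J \<subseteq> K \<and> K \<subseteq> {1..n}}"
    by (rule finite_subset[of _ "Pow {1..n}"]) auto
  have "(\<Inter>j\<in>J. gen_event n j) = {K. J \<subseteq> K \<and> K \<subseteq> {1..n}}"
    using assms(4) by (auto simp: gen_event_def sample_space_def)
  then show ?thesis
    using fin assms by (auto intro!: measure_eq_sum_singleton simp: sample_space_def)
qed

text \<open>The equation at the empty set is total mass 1, those at singletons are the marginals,
  and the remaining ones are the independence conditions.\<close>

lemma admissible_iff_superset_sums:
  assumes n: "2 \<le> n"
  shows "P \<in> admissible n a \<longleftrightarrow>
    prob_space P \<and> space P = sample_space n \<and> sets P = Pow (sample_space n) \<and>
    (\<forall>J. J \<subset> {1..n} \<longrightarrow> (\<Sum>K | J \<subseteq> K \<and> K \<subseteq> {1..n}. measure P {K}) = (\<Prod>j\<in>J. a j))"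
proof (cases "prob_space P \<and> space P = sample_space n \<and> sets P = Pow (sample_space n)")
  case True
  then interpret prob_space P by simp
  note P = prob_space_axioms True[THEN conjunct2, THEN conjunct1] True[THEN conjunct2, THEN conjunct2]
  let ?D = "\<lambda>J. \<Sum>K | J \<subseteq> K \<and> K \<subseteq> {1..n}. measure P {K}"
  have ev: "gen_event n j \<in> sets P" for j using P(3) by (auto simp: gen_event_def)
  have D: "measure P (\<Inter>j\<in>J. gen_event n j) = ?D J" if "J \<noteq> {}" for J
    by (rule measure_Inter_gen_event[OF P that])
  have D1: "measure P (gen_event n j) = ?D {j}" for j
    using D[of "{j}"] by simp
  have D0: "?D {} = 1"
  proof -
    have sp: "{K. {} \<subseteq> K \<and> K \<subseteq> {1..n}} = space P" using P(2) by (auto simp: sample_space_def)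
    have "measure P (space P) = (\<Sum>K\<in>space P. measure P {K})"
      by (rule measure_eq_sum_singleton) (use P in \<open>auto simp: sample_space_def\<close>)
    then show ?thesis unfolding sp by (simp add: prob_space)
  qed
  have proper: "J \<subset> {1..n} \<longleftrightarrow> J \<subseteq> {1..n} \<and> card J \<le> n - 1" for J
    using n psubset_card_mono[of "{1..n}" J] by fastforce
  \<comment> \<open>This is where \<open>n\<close> must be at least 2: the marginals have to be
    among the equations for proper subsets.\<close>
  have single: "{j} \<subset> {1..n}" if "j \<in> {1..n}" for j
    using proper[of "{j}"] that n by auto
  have kw: "kwise_indep_events (n - 1) P (gen_event n) n \<longleftrightarrow>
    (\<forall>J. J \<subset> {1..n} \<and> J \<noteq> {} \<longrightarrow> ?D J = (\<Prod>j\<in>J. ?D {j}))"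
  proof -
    have "kwise_indep_events (n - 1) P (gen_event n) n \<longleftrightarrow>
      (\<forall>J. J \<subseteq> {1..n} \<and> J \<noteq> {} \<and> card J \<le> n - 1 \<longrightarrow>
        measure P (\<Inter>j\<in>J. gen_event n j) = (\<Prod>j\<in>J. measure P (gen_event n j)))"
      by (rule kwise_indep_events_iff[OF P(1) ev]) simp
    also have "\<dots> \<longleftrightarrow> (\<forall>J. J \<subset> {1..n} \<and> J \<noteq> {} \<longrightarrow> ?D J = (\<Prod>j\<in>J. ?D {j}))"
    proof (rule arg_cong[of _ _ All], rule ext)
      fix J
      show "(J \<subseteq> {1..n} \<and> J \<noteq> {} \<and> card J \<le> n - 1 \<longrightarrow>
          measure P (\<Inter>j\<in>J. gen_event n j) = (\<Prod>j\<in>J. measure P (gen_event n j))) \<longleftrightarrow>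
        (J \<subset> {1..n} \<and> J \<noteq> {} \<longrightarrow> ?D J = (\<Prod>j\<in>J. ?D {j}))"
        unfolding proper D1 using D[of J] by argo
    qed
    finally show ?thesis .
  qed
  have "(\<forall>j\<in>{1..n}. ?D {j} = a j) \<and> (\<forall>J. J \<subset> {1..n} \<and> J \<noteq> {} \<longrightarrow> ?D J = (\<Prod>j\<in>J. ?D {j}))
    \<longleftrightarrow> (\<forall>J. J \<subset> {1..n} \<longrightarrow> ?D J = (\<Prod>j\<in>J. a j))" (is "?A \<and> ?B \<longleftrightarrow> ?C")
  proof
    assume AB: "?A \<and> ?B"
    show ?C
    proof (intro allI impI)
      fix J assume J: "J \<subset> {1..n}"
      have "(\<Prod>j\<in>J. ?D {j}) = (\<Prod>j\<in>J. a j)"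
        by (rule prod.cong) (use AB J in auto)
      moreover have "J \<noteq> {} \<Longrightarrow> ?D J = (\<Prod>j\<in>J. ?D {j})" using AB J by blast
      ultimately show "?D J = (\<Prod>j\<in>J. a j)" using D0 by (cases "J = {}") simp_all
    qed
  next
    assume C: ?C
    have A: "?D {j} = a j" if "j \<in> {1..n}" for j
      using C[rule_format, OF single[OF that]] by simp
    moreover have "?D J = (\<Prod>j\<in>J. ?D {j})" if "J \<subset> {1..n}" for J
    proof -
      have "(\<Prod>j\<in>J. ?D {j}) = (\<Prod>j\<in>J. a j)"
        by (rule prod.cong) (use A that in auto)
      then show ?thesis using C[rule_format, OF that] by simp
    qed
    ultimately show "?A \<and> ?B" by blast
  qed
  then show ?thesis using P unfolding admissible_def mem_Collect_eq kw by (simp add: D1)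
qed (auto simp: admissible_def)

lemma admissible_iff_perturbed_weights:
  assumes n: "2 \<le> n"
  shows "P \<in> admissible n a \<longleftrightarrow>
    prob_space P \<and> space P = sample_space n \<and> sets P = Pow (sample_space n) \<and>
    (\<exists>s. has_perturbed_weights n a s P)"
proof -
  let ?D = "\<lambda>f J. \<Sum>K | J \<subseteq> K \<and> K \<subseteq> {1..n}. f K"
  have "(\<forall>J. J \<subset> {1..n} \<longrightarrow> ?D (\<lambda>K. measure P {K}) J = (\<Prod>j\<in>J. a j)) \<longleftrightarrow>
    (\<exists>s. has_perturbed_weights n a s P)" (is "?L \<longleftrightarrow> ?R")
  proof
    assume L: ?L
    \<comment> \<open>Chosen so that the error \<open>e\<close> vanishes at the full set. This
      supplies the one equation missing from the triangular system, which then forces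
      \<open>e\<close> to be 0 everywhere.\<close>
    define s where "s = (-1) ^ n * (measure P {{1..n}} - indep_weight n a {1..n})"
    define e where "e K = measure P {K} - indep_weight n a K - (-1) ^ card K * s" for K
    have De: "?D e J = ?D (\<lambda>K. measure P {K}) J - ?D (indep_weight n a) J
        - ?D (\<lambda>K. (-1) ^ card K) J * s" for J
      by (simp add: e_def sum_subtractf sum_distrib_right)
    have "?D e J = 0" if "J \<subseteq> {1..n}" for J
    proof (cases "J = {1..n}")
      case True
      then have "{K. J \<subseteq> K \<and> K \<subseteq> {1..n}} = {{1..n}}" by auto
      then show ?thesis by (simp add: e_def s_def mult.assoc[symmetric] flip: power_add)
    next
      case False
      then have "J \<subset> {1..n}" using that by auto
      then show ?thesis
        using De[of J] L sum_supersets_indep_weight[OF that] sum_supersets_alternating[of "{1..n}" J]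
        by simp
    qed
    then have "e J = 0" if "J \<subseteq> {1..n}" for J
      using sum_supersets_eq_0_imp_eq_0[OF _ that] by blast
    then have "measure P {J} = indep_weight n a J + (-1) ^ card J * s" if "J \<subseteq> {1..n}" for J
      using that unfolding e_def by (metis (no_types, lifting) diff_diff_eq eq_iff_diff_eq_0)
    then have "has_perturbed_weights n a s P"
      by (simp add: has_perturbed_weights_def atom_event_eq)
    then show ?R ..
  next
    assume ?R
    then obtain s where s: "has_perturbed_weights n a s P" ..
    show ?L
    proof (intro allI impI)
      fix J assume J: "J \<subset> {1..n}"
      have "?D (\<lambda>K. measure P {K}) J = ?D (\<lambda>K. indep_weight n a K + (-1) ^ card K * s) J"
        using s by (intro sum.cong) (auto simp: has_perturbed_weights_def atom_event_eq)
      also have "\<dots> = ?D (indep_weight n a) J + ?D (\<lambda>K. (-1) ^ card K) J * s"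
        by (simp add: sum.distrib sum_distrib_right)
      also have "\<dots> = (\<Prod>j\<in>J. a j)"
        using J sum_supersets_indep_weight[of J n a] sum_supersets_alternating[of "{1..n}" J] by auto
      finally show "?D (\<lambda>K. measure P {K}) J = (\<Prod>j\<in>J. a j)" .
    qed
  qed
  then show ?thesis unfolding admissible_iff_superset_sums[OF n] by simp
qed

lemma prob_at_least_perturbed:
  assumes "has_perturbed_weights n a s P" "k \<in> {1..n}"
  shows "prob_at_least n k P
    = indep_prob_at_least n k a + (-1) ^ k * real ((n - 1) choose (k - 1)) * s"
proof -
  have "prob_at_least n k P
    = (\<Sum>J | J \<subseteq> {1..n} \<and> k \<le> card J. indep_weight n a J + (-1) ^ card J * s)"
    unfolding prob_at_least_def
    by (rule sum.cong) (use assms(1) in \<open>auto simp: has_perturbed_weights_def\<close>)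
  then show ?thesis
    by (simp only: sum.distrib sum_distrib_right[symmetric] sum_alternating_card_ge[OF assms(2)]
        indep_prob_at_least_def)
qed

lemma perturbed_measure_unique:
  assumes "P \<in> admissible n a" "Q \<in> admissible n a"
    and "has_perturbed_weights n a s P" "has_perturbed_weights n a s Q"
  shows "P = Q"
proof (rule measure_eqI_finite[where A = "sample_space n"])
  show "sets P = Pow (sample_space n)" "sets Q = Pow (sample_space n)"
    using assms by (auto simp: admissible_def)
  show "finite (sample_space n)" by (simp add: sample_space_def)
  interpret P: prob_space P using assms by (simp add: admissible_def)
  interpret Q: prob_space Q using assms by (simp add: admissible_def)
  fix K assume "K \<in> sample_space n"
  then show "emeasure P {K} = emeasure Q {K}"
    using assms(3,4)
    by (simp add: P.emeasure_eq_measure Q.emeasure_eq_measure has_perturbed_weights_def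
        sample_space_def atom_event_eq)
qed

text \<open>The perturbed weights serve as point masses; nonnegativity matters because
  \<open>ennreal\<close> would truncate negative values to 0.\<close>

lemma perturbed_measure_exists:
  assumes n: "2 \<le> n" and nn: "\<And>J. J \<subseteq> {1..n} \<Longrightarrow> 0 \<le> indep_weight n a J + (-1) ^ card J * s"
  shows "\<exists>Q \<in> admissible n a. has_perturbed_weights n a s Q"
proof -
  define w where "w J = indep_weight n a J + (-1) ^ card J * s" for J
  define Q where "Q = point_measure (sample_space n) (\<lambda>J. ennreal (w J))"
  have fin: "finite (sample_space n)" by (simp add: sample_space_def)
  have em: "emeasure Q X = ennreal (\<Sum>J\<in>X. w J)" if "X \<subseteq> sample_space n" for X
  proof -
    have "emeasure Q X = (\<Sum>J\<in>X. ennreal (w J))"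
      unfolding Q_def using fin that by (rule emeasure_point_measure_finite)
    then show ?thesis
      using nn that by (subst (asm) sum_ennreal) (auto simp: w_def sample_space_def)
  qed
  have sp: "space Q = sample_space n" "sets Q = Pow (sample_space n)"
    by (simp_all add: Q_def space_point_measure sets_point_measure)
  have "{} \<subset> {1..n}" using n by auto
  \<comment> \<open>The superset sums at the empty set: the independent weights add up to 1 and the
    alternating part cancels.\<close>
  then have "(\<Sum>J\<in>sample_space n. w J) = 1"
    using sum_supersets_indep_weight[of "{}" n a] sum_supersets_alternating[of "{1..n}" "{}"]
    by (simp add: w_def sum.distrib sample_space_def Pow_def flip: sum_distrib_right)
  then have "prob_space Q" using em[of "sample_space n"] sp by (intro prob_spaceI) simp
  moreover have hp: "has_perturbed_weights n a s Q"
    using em nn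
    by (auto simp: has_perturbed_weights_def atom_event_eq measure_def w_def sample_space_def)
  ultimately show ?thesis
    using sp admissible_iff_perturbed_weights[OF n] by blast
qed

lemma perturbation_range:
  assumes n: "2 \<le> n" and P: "P \<in> admissible n a" "has_perturbed_weights n a s P"
    and J: "J \<subseteq> {1..n}"
  shows "even (card J) \<Longrightarrow> - indep_weight n a J \<le> s" "odd (card J) \<Longrightarrow> s \<le> indep_weight n a J"
proof -
  have "0 \<le> indep_weight n a J + (-1) ^ card J * s"
    using P(2) J measure_nonneg[of P "atom_event n J"] by (auto simp: has_perturbed_weights_def)
  then show "even (card J) \<Longrightarrow> - indep_weight n a J \<le> s" "odd (card J) \<Longrightarrow> s \<le> indep_weight n a J"
    by simp_all
qed

section \<open>Bounds, sharpness and uniqueness from the interval of perturbations\<close>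

theorem theorem13:
  fixes n k p m :: nat and a :: "nat \<Rightarrow> real"
  assumes n: "2 \<le> n" and k: "k \<in> {1..n}"
    and a_range: "0 \<le> a 1" "a n \<le> 1" and a_mono: "mono_on {1..n} a"
    and p: "p = Max {q \<in> {0..(n - 1) div 2}. \<forall>i\<in>{1..q}. a (2 * i) + a (2 * i + 1) \<le> 1}"
    and m: "m = Max {q \<in> {0..n div 2}. \<forall>i\<in>{1..q}. a (2 * i - 1) + a (2 * i) \<le> 1}"
  shows
    "(odd k \<longrightarrow>
       (\<forall>P \<in> admissible n a.
          indep_prob_at_least n k a - real ((n - 1) choose (k - 1)) * prefix_prod n a (2 * p + 1)
            \<le> prob_at_least n k P \<and>
          prob_at_least n k P
            \<le> indep_prob_at_least n k a + real ((n - 1) choose (k - 1)) * prefix_prod n a (2 * m)) \<and>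
       (\<exists>Q. has_perturbed_weights n a (prefix_prod n a (2 * p + 1)) Q \<and>
          {P \<in> admissible n a. prob_at_least n k P =
             indep_prob_at_least n k a - real ((n - 1) choose (k - 1)) * prefix_prod n a (2 * p + 1)}
          = {Q}) \<and>
       (\<exists>Q. has_perturbed_weights n a (- prefix_prod n a (2 * m)) Q \<and>
          {P \<in> admissible n a. prob_at_least n k P =
             indep_prob_at_least n k a + real ((n - 1) choose (k - 1)) * prefix_prod n a (2 * m)}
          = {Q})) \<and>
     (even k \<longrightarrow>
       (\<forall>P \<in> admissible n a.
          indep_prob_at_least n k a - real ((n - 1) choose (k - 1)) * prefix_prod n a (2 * m)
            \<le> prob_at_least n k P \<and>
          prob_at_least n k P
            \<le> indep_prob_at_least n k a + real ((n - 1) choose (k - 1)) * prefix_prod n a (2 * p + 1)) \<and>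
       (\<exists>Q. has_perturbed_weights n a (- prefix_prod n a (2 * m)) Q \<and>
          {P \<in> admissible n a. prob_at_least n k P =
             indep_prob_at_least n k a - real ((n - 1) choose (k - 1)) * prefix_prod n a (2 * m)}
          = {Q}) \<and>
       (\<exists>Q. has_perturbed_weights n a (prefix_prod n a (2 * p + 1)) Q \<and>
          {P \<in> admissible n a. prob_at_least n k P =
             indep_prob_at_least n k a + real ((n - 1) choose (k - 1)) * prefix_prod n a (2 * p + 1)}
          = {Q}))"
proof -
  note a = a_range a_mono
  define u where "u = prefix_prod n a (2 * p + 1)"
  define l where "l = prefix_prod n a (2 * m)"
  define B where "B = real ((n - 1) choose (k - 1))"
  \<comment> \<open>A nonzero slope lets the value of \<open>prob_at_least\<close> determine the
    perturbation, which gives uniqueness.\<close>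
  have B: "0 < B" using k by (auto simp: B_def)
  have n1: "1 \<le> n" using n by simp
  note minE = even_prefix_minimal[OF a m, folded l_def]
    and minO = odd_prefix_minimal[OF a n1 p, folded u_def]
  have nonneg: "0 \<le> prefix_prod n a r" if "r \<le> n" for r
    unfolding prefix_prod_def using sorted_unit_interval[OF a] that
    by (intro mult_nonneg_nonneg prod_nonneg) auto
  have "0 \<le> u" "0 \<le> l" using nonneg minE(1) minO(1) by (auto simp: u_def l_def)
  have value_eq: "prob_at_least n k P = indep_prob_at_least n k a + (-1) ^ k * B * s"
    if "has_perturbed_weights n a s P" for P s
    using prob_at_least_perturbed[OF that k] by (simp add: B_def)
  \<comment> \<open>The prefixes of sizes \<open>2 * m\<close> and \<open>2 * p + 1\<close> are
    themselves an even and an odd set, so the signs of their atoms bound \<open>s\<close> on both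
    sides.\<close>
  have range: "\<exists>s. has_perturbed_weights n a s P \<and> - l \<le> s \<and> s \<le> u" if P: "P \<in> admissible n a" for P
  proof -
    obtain s where s: "has_perturbed_weights n a s P"
      using P admissible_iff_perturbed_weights[OF n] by blast
    have "- l \<le> s" "s \<le> u"
      using perturbation_range[OF n P s, of "{1..2 * m}"] perturbation_range[OF n P s, of "{1..2 * p + 1}"]
        minE(1) minO(1) indep_weight_prefix[OF minE(1)] indep_weight_prefix[OF minO(1)]
      by (auto simp: u_def l_def)
    with s show ?thesis by blast
  qed
  have sharp: "\<exists>Q. has_perturbed_weights n a s Q \<and>
      {P \<in> admissible n a. prob_at_least n k P = indep_prob_at_least n k a + (-1) ^ k * B * s} = {Q}"
    if s: "- l \<le> s" "s \<le> u" for s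
  proof -
    \<comment> \<open>Conversely, minimality of \<open>l\<close> and \<open>u\<close> within their
      parities makes every weight nonnegative for each \<open>s\<close> in the interval.\<close>
    have "0 \<le> indep_weight n a J + (-1) ^ card J * s" if "J \<subseteq> {1..n}" for J
      using minE(2)[OF that] minO(2)[OF that] s by (cases "even (card J)") auto
    then obtain Q where Q: "Q \<in> admissible n a" "has_perturbed_weights n a s Q"
      using perturbed_measure_exists[OF n] by blast
    have "P = Q" if P: "P \<in> admissible n a"
      and eq: "prob_at_least n k P = indep_prob_at_least n k a + (-1) ^ k * B * s" for P
    proof -
      obtain t where t: "has_perturbed_weights n a t P" using range[OF P] by blast
      then have "t = s" using value_eq[OF t] eq B by simp
      then show ?thesis using perturbed_measure_unique[OF P Q(1) _ Q(2)] t by simp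
    qed
    then show ?thesis using Q value_eq[OF Q(2)] by blast
  qed
  have bounds: "- (B * l) \<le> B * s" "B * s \<le> B * u" if "- l \<le> s" "s \<le> u" for s
    using mult_left_mono[of "- l" s B] mult_left_mono[of s u B] B that by auto
  show ?thesis
    unfolding B_def[symmetric] u_def[symmetric] l_def[symmetric]
    \<comment> \<open>The extremes occur at the endpoints \<open>u\<close> and \<open>- l\<close>,
      both admissible since \<open>- l \<le> 0 \<le> u\<close>; the sign \<open>(-1) ^ k\<close>
      decides which gives the upper bound.\<close>
    using sharp[of u] sharp[of "- l"] \<open>0 \<le> u\<close> \<open>0 \<le> l\<close>
    by (auto dest!: range simp: value_eq dest: bounds)
qed

end
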